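(* Let $V_{\mathbb H}^R$ be a separable right quaternionic Hilbert space, $A\in\mathcal B(V_{\mathbb H}^R)$ and $\mathfrak q\in\mathbb H$. Then: (a) $\mathfrak q\in\sigma_c^S(A)$ if and only if $\overline{\mathfrak q}\in\sigma_{pS}(A^\dagger)$; (b) $\sigma_c^S(A)\subseteq\sigma_r^S(A)$; (c) $\sigma_S(A)=\sigma_{ap}^S(A)\cup\sigma_c^S(A)$.
   Context: $\mathbb H$ denotes the quaternions. A right quaternionic Hilbert space is a right $\mathbb H$-vector space, complete for the norm of an $\mathbb H$-valued inner product $\langle\cdot|\cdot\rangle$ satisfying $\overline{\langle\phi|\psi\rangle}=\langle\psi|\phi\rangle$, $\|\phi\|^2=\langle\phi|\phi\rangle>0$ for $\phi\ne0$, additivity, $\langle\phi|\psi\mathfrak q\rangle=\langle\phi|\psi\rangle\mathfrak q$ and $\langle\phi\mathfrak q|\psi\rangle=\overline{\mathfrak q}\langle\phi|\psi\rangle$. $\mathcal B(V_{\mathbb H}^R)$ is the set of bounded right $\mathbb H$-linear operators on $V_{\mathbb H}^R$, $\mathbb I$ is the identity, and $A^\dagger$ is the adjoint: $\langle\psi|A\phi\rangle=\langle A^\dagger\psi|\phi\rangle$. For $\mathfrak q\in\mathbb H$, $R_{\mathfrak q}(A)=A^2-2\,\mathrm{Re}(\mathfrak q)A+|\mathfrak q|^2\mathbb I$. Definitions: $\sigma_S(A)=\{\mathfrak q: R_{\mathfrak q}(A)\text{ has no inverse in }\mathcal B(V_{\mathbb H}^R)\}$ ($S$-spectrum); $\sigma_{pS}(A)=\{\mathfrak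 q:\ker R_{\mathfrak q}(A)\ne\{0\}\}$ (spherical point spectrum); $\sigma_r^S(A)=\{\mathfrak q: R_{\mathfrak q}(A)\text{ is not right invertible in }\mathcal B(V_{\mathbb H}^R)\}$ (right $S$-spectrum); $\sigma_c^S(A)=\{\mathfrak q:\mathrm{ran}(R_{\mathfrak q}(A))\text{ is not dense in }V_{\mathbb H}^R\}$ (spherical compression spectrum); $\sigma_{ap}^S(A)=\{\mathfrak q:\text{there is a sequence }(\phi_n)\text{ with }\|\phi_n\|=1\text{ for all }n\text{ and }\|R_{\mathfrak q}(A)\phi_n\|\to0\}$ (approximate $S$-point spectrum). *)

theory Defs
  imports "HOL-Analysis.Analysis"
begin

section \<open>Quaternions\<close>

datatype quat = Quat (qRe: real) (qIm1: real) (qIm2: real) (qIm3: real)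

lemma quat_eq_iff:
  "p = q \<longleftrightarrow> qRe p = qRe q \<and> qIm1 p = qIm1 q \<and> qIm2 p = qIm2 q \<and> qIm3 p = qIm3 q"
  by (auto intro: quat.expand)

definition qcnj :: "quat \<Rightarrow> quat" where
  "qcnj q = Quat (qRe q) (- qIm1 q) (- qIm2 q) (- qIm3 q)"

lemma qcnj_sel [simp]:
  "qRe (qcnj q) = qRe q" "qIm1 (qcnj q) = - qIm1 q"
  "qIm2 (qcnj q) = - qIm2 q" "qIm3 (qcnj q) = - qIm3 q"
  by (simp_all add: qcnj_def)

instantiation quat :: ab_group_add
begin

definition "0 = Quat 0 0 0 0"

definition "p + q = Quat (qRe p + qRe q) (qIm1 p + qIm1 q) (qIm2 p + qIm2 q) (qIm3 p + qIm3 q)"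

definition "p - q = Quat (qRe p - qRe q) (qIm1 p - qIm1 q) (qIm2 p - qIm2 q) (qIm3 p - qIm3 q)"

definition "- q = Quat (- qRe q) (- qIm1 q) (- qIm2 q) (- qIm3 q)"

instance
  by standard (simp_all add: zero_quat_def plus_quat_def minus_quat_def uminus_quat_def quat_eq_iff)

end

lemma quat_additive_sel [simp]:
  "qRe 0 = 0" "qIm1 0 = 0" "qIm2 0 = 0" "qIm3 0 = 0"
  "qRe (p + q) = qRe p + qRe q" "qIm1 (p + q) = qIm1 p + qIm1 q"
  "qIm2 (p + q) = qIm2 p + qIm2 q" "qIm3 (p + q) = qIm3 p + qIm3 q"
  "qRe (p - q) = qRe p - qRe q" "qIm1 (p - q) = qIm1 p - qIm1 q"
  "qIm2 (p - q) = qIm2 p - qIm2 q" "qIm3 (p - q) = qIm3 p - qIm3 q"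
  "qRe (- q) = - qRe q" "qIm1 (- q) = - qIm1 q"
  "qIm2 (- q) = - qIm2 q" "qIm3 (- q) = - qIm3 q"
  by (simp_all add: zero_quat_def plus_quat_def minus_quat_def uminus_quat_def)

instantiation quat :: real_algebra_1
begin

definition "1 = Quat 1 0 0 0"

definition "p * q = Quat
  (qRe p * qRe q - qIm1 p * qIm1 q - qIm2 p * qIm2 q - qIm3 p * qIm3 q)
  (qRe p * qIm1 q + qIm1 p * qRe q + qIm2 p * qIm3 q - qIm3 p * qIm2 q)
  (qRe p * qIm2 q - qIm1 p * qIm3 q + qIm2 p * qRe q + qIm3 p * qIm1 q)
  (qRe p * qIm3 q + qIm1 p * qIm2 q - qIm2 p * qIm1 q + qIm3 p * qRe q)"

definition "r *\<^sub>R q = Quat (r * qRe q) (r * qIm1 q) (r * qIm2 q) (r * qIm3 q)"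

instance
  by standard
    (simp_all add: one_quat_def times_quat_def scaleR_quat_def quat_eq_iff algebra_simps)

end

lemma quat_mult_sel [simp]:
  "qRe 1 = 1" "qIm1 1 = 0" "qIm2 1 = 0" "qIm3 1 = 0"
  "qRe (p * q) = qRe p * qRe q - qIm1 p * qIm1 q - qIm2 p * qIm2 q - qIm3 p * qIm3 q"
  "qIm1 (p * q) = qRe p * qIm1 q + qIm1 p * qRe q + qIm2 p * qIm3 q - qIm3 p * qIm2 q"
  "qIm2 (p * q) = qRe p * qIm2 q - qIm1 p * qIm3 q + qIm2 p * qRe q + qIm3 p * qIm1 q"
  "qIm3 (p * q) = qRe p * qIm3 q + qIm1 p * qIm2 q - qIm2 p * qIm1 q + qIm3 p * qRe q"
  "qRe (r *\<^sub>R q) = r * qRe q" "qIm1 (r *\<^sub>R q) = r * qIm1 q"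
  "qIm2 (r *\<^sub>R q) = r * qIm2 q" "qIm3 (r *\<^sub>R q) = r * qIm3 q"
  by (simp_all add: one_quat_def times_quat_def scaleR_quat_def)

lemma quat_of_real_sel [simp]:
  "qRe (of_real r) = r" "qIm1 (of_real r) = 0" "qIm2 (of_real r) = 0" "qIm3 (of_real r) = 0"
  by (simp_all add: of_real_def)

instantiation quat :: real_normed_div_algebra
begin

definition "norm q = sqrt ((qRe q)\<^sup>2 + (qIm1 q)\<^sup>2 + (qIm2 q)\<^sup>2 + (qIm3 q)\<^sup>2)"

definition "inverse q = inverse ((norm q)\<^sup>2) *\<^sub>R qcnj q" for q :: quat

definition "p div q = p * inverse q" for p q :: quat

definition "sgn q = inverse (norm q) *\<^sub>R q" for q :: quat

definition "dist p q = norm (p - q)" for p q :: quat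

definition [code del]:
  "(uniformity :: (quat \<times> quat) filter) = (INF e\<in>{0 <..}. principal {(x, y). dist x y < e})"

definition [code del]:
  "open (U :: quat set) \<longleftrightarrow>
    (\<forall>x\<in>U. eventually (\<lambda>(x', y). x' = x \<longrightarrow> y \<in> U) uniformity)"

instance
proof
  fix p q :: quat and r :: real and U :: "quat set"
  define v where "v q = (qRe q, qIm1 q, qIm2 q, qIm3 q)" for q
  have v: "norm q = norm (v q)" for q
    by (simp add: norm_quat_def v_def norm_Pair add.assoc)
  have v0: "v q = 0 \<longleftrightarrow> q = 0" for q
    by (simp add: v_def zero_prod_def quat_eq_iff)
  have v_add: "v (p + q) = v p + v q" for p q
    by (simp add: v_def)
  have v_scale: "v (r *\<^sub>R q) = r *\<^sub>R v q" for r q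
    by (simp add: v_def)
  have norm_sq: "(norm q)\<^sup>2 = (qRe q)\<^sup>2 + (qIm1 q)\<^sup>2 + (qIm2 q)\<^sup>2 + (qIm3 q)\<^sup>2" for q :: quat
    by (simp add: norm_quat_def)
  have cnj: "q * qcnj q = ((norm q)\<^sup>2) *\<^sub>R 1" "qcnj q * q = ((norm q)\<^sup>2) *\<^sub>R 1" for q
    unfolding norm_sq by (simp_all add: quat_eq_iff power2_eq_square)
  show n0: "norm q = 0 \<longleftrightarrow> q = 0" for q :: quat
    by (simp add: v v0)
  show "norm (p + q) \<le> norm p + norm q"
    unfolding v v_add by (rule norm_triangle_ineq)
  show "norm (r *\<^sub>R q) = \<bar>r\<bar> * norm q"
    unfolding v v_scale by simp
  have "(norm (p * q))\<^sup>2 = (norm p * norm q)\<^sup>2"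
    unfolding power_mult_distrib norm_sq by (simp add: power2_eq_square algebra_simps)
  moreover have "norm q \<ge> 0" for q :: quat
    by (simp add: v)
  ultimately show "norm (p * q) = norm p * norm q"
    by (metis mult_nonneg_nonneg power2_eq_imp_eq)
  show "inverse q * q = 1" "q * inverse q = 1" if "q \<noteq> 0"
    using that n0[of q] by (simp_all add: inverse_quat_def cnj)
  show "inverse (0 :: quat) = 0"
    by (simp add: inverse_quat_def quat_eq_iff)
qed (auto simp: divide_quat_def sgn_quat_def dist_quat_def uniformity_quat_def open_quat_def)

end

section \<open>Right quaternionic Hilbert spaces\<close>

text \<open>The real scalar multiplication of the library class is the restriction of the right
  quaternionic one to the real, hence central, scalars.\<close>

class right_quat_vector = real_vector +
  fixes scaleH :: "'a \<Rightarrow> quat \<Rightarrow> 'a"  (infixl \<open>*\<^sub>H\<close> 75)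
  assumes scaleR_eq_scaleH: "r *\<^sub>R x = x *\<^sub>H of_real r"
    and scaleH_add_left: "(x + y) *\<^sub>H q = x *\<^sub>H q + y *\<^sub>H q"
    and scaleH_add_right: "x *\<^sub>H (p + q) = x *\<^sub>H p + x *\<^sub>H q"
    and scaleH_scaleH: "x *\<^sub>H p *\<^sub>H q = x *\<^sub>H (p * q)"
    and scaleH_one: "x *\<^sub>H 1 = x"

text \<open>The norm axioms of \<^class>\<open>real_normed_vector\<close> restrict nothing: they follow from
  those of the inner product. They are included to obtain the norm topology of the library.
  Positivity of the inner product is \<open>norm_sq_eq_qinner\<close>.\<close>

class right_quat_inner = right_quat_vector + real_normed_vector +
  fixes qinner :: "'a \<Rightarrow> 'a \<Rightarrow> quat"
  assumes qcnj_qinner: "qcnj (qinner x y) = qinner y x"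
    and qinner_add_right: "qinner x (y + z) = qinner x y + qinner x z"
    and qinner_scaleH_right: "qinner x (y *\<^sub>H q) = qinner x y * q"
    and qinner_scaleH_left: "qinner (x *\<^sub>H q) y = qcnj q * qinner x y"
    and norm_sq_eq_qinner: "of_real ((norm x)\<^sup>2) = qinner x x"

class right_quat_hilbert = right_quat_inner + complete_space

section \<open>Bounded right linear operators and their adjoints\<close>

definition bounded_right_ops :: "('a::right_quat_hilbert \<Rightarrow> 'a) set" where
  "bounded_right_ops = {A. bounded_linear A \<and> (\<forall>x q. A (x *\<^sub>H q) = A x *\<^sub>H q)}"

text \<open>For \<^term>\<open>A \<in> bounded_right_ops\<close> exactly one such \<open>B\<close> exists, by the Riesz
  representation theorem.\<close>

definition qadjoint :: "('a::right_quat_hilbert \<Rightarrow> 'a) \<Rightarrow> 'a \<Rightarrow> 'a" where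
  "qadjoint A = (THE B. \<forall>\<phi> \<psi>. qinner \<psi> (A \<phi>) = qinner (B \<psi>) \<phi>)"

section \<open>The spectra\<close>

definition R_op :: "quat \<Rightarrow> ('a::right_quat_hilbert \<Rightarrow> 'a) \<Rightarrow> 'a \<Rightarrow> 'a" where
  "R_op q A \<phi> = A (A \<phi>) - (2 * qRe q) *\<^sub>R A \<phi> + (norm q)\<^sup>2 *\<^sub>R \<phi>"

definition S_spectrum :: "('a::right_quat_hilbert \<Rightarrow> 'a) \<Rightarrow> quat set" where
  "S_spectrum A =
    {q. \<not> (\<exists>B\<in>bounded_right_ops. R_op q A \<circ> B = id \<and> B \<circ> R_op q A = id)}"

definition spherical_point_spectrum :: "('a::right_quat_hilbert \<Rightarrow> 'a) \<Rightarrow> quat set" where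
  "spherical_point_spectrum A = {q. {\<phi>. R_op q A \<phi> = 0} \<noteq> {0}}"

definition right_S_spectrum :: "('a::right_quat_hilbert \<Rightarrow> 'a) \<Rightarrow> quat set" where
  "right_S_spectrum A = {q. \<not> (\<exists>B\<in>bounded_right_ops. R_op q A \<circ> B = id)}"

definition spherical_compression_spectrum :: "('a::right_quat_hilbert \<Rightarrow> 'a) \<Rightarrow> quat set" where
  "spherical_compression_spectrum A = {q. closure (range (R_op q A)) \<noteq> UNIV}"

definition approx_S_point_spectrum :: "('a::right_quat_hilbert \<Rightarrow> 'a) \<Rightarrow> quat set" where
  "approx_S_point_spectrum A =
    {q. \<exists>\<phi>::nat \<Rightarrow> 'a. (\<forall>n. norm (\<phi> n) = 1) \<and> (\<lambda>n. norm (R_op q A (\<phi> n))) \<longlonglongrightarrow> 0}"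

end

theory Submission
  imports Defs
begin

text \<open>
  Everything rests on the real part of the quaternionic inner product. It is a real inner product
  inducing the given norm, so the variational proof of the Riesz theorem applies: on a closed
  real subspace \<open>M\<close> the strictly convex function \<open>\<parallel>x\<parallel>\<^sup>2 - 2 f x\<close> attains its minimum, and the minimiser
  represents the bounded functional \<open>f\<close> on \<open>M\<close> (\<open>riesz_closed_subspace\<close>). With \<open>M\<close> the whole space this
  yields the adjoint, a quaternion \<open>p\<close> being determined by the real parts of the products \<open>p * r\<close>;
  with \<open>f = \<langle>v|\<cdot>\<rangle>\<close> for some \<open>v\<close> outside \<open>M\<close> it yields a nonzero vector orthogonal to \<open>M\<close>.

  The coefficients of \<open>R\<^sub>q(A)\<close> are real and do not change when \<open>q\<close> is conjugated, so the adjoint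
  of \<open>R\<^sub>q(A)\<close> is \<open>R\<^sub>q\<close> of the adjoint of \<open>A\<close>, with \<open>q\<close> conjugated. Its kernel is the orthogonal complement of
  the range of \<open>R\<^sub>q(A)\<close>, which vanishes exactly when that range is dense; this is (a). A right
  invertible operator is surjective, whence (b). For (c), \<open>q\<close> lies outside the approximate point
  spectrum exactly when \<open>R\<^sub>q(A)\<close> is bounded below. An operator that is bounded below is injective with
  closed range; if the range is also dense, it is bijective, and the lower bound is a
  bound for the inverse.
\<close>

section \<open>The real inner product\<close>

text \<open>Passing to real parts loses no information about orthogonality to a right subspace, and it
  avoids the noncommutativity of the scalars.\<close>

definition rinner :: "'a::right_quat_inner \<Rightarrow> 'a \<Rightarrow> real" where
  "rinner x y = qRe (qinner x y)"

lemma rinner_commute: "rinner x y = rinner y x"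
  unfolding rinner_def by (metis qcnj_qinner qcnj_sel(1))

lemma rinner_add_right: "rinner x (y + z) = rinner x y + rinner x z"
  by (simp add: rinner_def qinner_add_right)

lemma rinner_scaleR_right: "rinner x (r *\<^sub>R y) = r * rinner x y"
  by (simp add: rinner_def scaleR_eq_scaleH qinner_scaleH_right)

lemma rinner_add_left: "rinner (x + y) z = rinner x z + rinner y z"
  by (metis rinner_commute rinner_add_right)

lemma rinner_scaleR_left: "rinner (r *\<^sub>R x) y = r * rinner x y"
  by (metis rinner_commute rinner_scaleR_right)

lemma rinner_minus_right: "rinner x (- y) = - rinner x y"
  using rinner_scaleR_right[of x "-1" y] by simp

lemma rinner_diff_right: "rinner x (y - z) = rinner x y - rinner x z"
  using rinner_add_right[of x y "- z"] by (simp add: rinner_minus_right)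

lemma rinner_diff_left: "rinner (x - y) z = rinner x z - rinner y z"
  by (metis rinner_commute rinner_diff_right)

lemma rinner_self: "rinner x x = (norm x)\<^sup>2"
  by (simp only: rinner_def quat_of_real_sel flip: norm_sq_eq_qinner)

lemma norm_sq_add: "(norm (x + y))\<^sup>2 = (norm x)\<^sup>2 + 2 * rinner x y + (norm y)\<^sup>2"
  by (simp add: rinner_add_left rinner_add_right rinner_commute[of y x] flip: rinner_self)

lemma parallelogram_law:
  "(norm (x - y))\<^sup>2 = 2 * (norm x)\<^sup>2 + 2 * (norm y)\<^sup>2 - (norm (x + y))\<^sup>2"
  for x y :: "'a::right_quat_inner"
  by (simp add: rinner_add_left rinner_add_right rinner_diff_left rinner_diff_right
      rinner_commute[of y x] flip: rinner_self)

text \<open>This is the first-order condition for a minimum at \<open>t = 0\<close>, applied below to the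
  variation \<open>y + t x\<close> of a minimiser \<open>y\<close>.\<close>

lemma linear_coeff_eq_0_if_quadratic_nonneg:
  fixes a b :: real
  assumes "a \<ge> 0" and nonneg: "\<And>t. t\<^sup>2 * a + 2 * t * b \<ge> 0"
  shows "b = 0"
proof (rule ccontr)
  assume "b \<noteq> 0"
  \<comment> \<open>For \<open>a > 0\<close> the minimiser is \<open>- b / a\<close>; the shifted denominator also covers \<open>a = 0\<close>.\<close>
  define t where "t = - b / (a + 1)"
  have b: "b = - t * (a + 1)" and "t \<noteq> 0"
    using \<open>a \<ge> 0\<close> \<open>b \<noteq> 0\<close> by (auto simp: t_def)
  have "t\<^sup>2 * a + 2 * t * b = - (t\<^sup>2 * (a + 2))"
    unfolding b by (simp add: algebra_simps power2_eq_square)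
  also have "\<dots> < 0"
    using \<open>a \<ge> 0\<close> \<open>t \<noteq> 0\<close> by simp
  finally show False
    using nonneg[of t] by linarith
qed

lemma abs_rinner_le: "\<bar>rinner x y\<bar> \<le> norm x * norm y"
proof (cases "y = 0")
  case True
  then show ?thesis
    using rinner_scaleR_right[of x 0 0] by simp
next
  case False
  define t where "t = - (rinner x y / (norm y)\<^sup>2)"
  have "0 \<le> (norm (x + t *\<^sub>R y))\<^sup>2"
    by simp
  also have "\<dots> = (norm x)\<^sup>2 - (rinner x y)\<^sup>2 / (norm y)\<^sup>2"
    using False unfolding norm_sq_add
    by (simp add: rinner_minus_right rinner_scaleR_right t_def field_simps power2_eq_square)
  finally have "(rinner x y)\<^sup>2 \<le> (norm x * norm y)\<^sup>2"
    using False by (simp add: field_simps power_mult_distrib)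
  then show ?thesis
    by (metis abs_le_square_iff abs_mult abs_norm_cancel)
qed

lemma bounded_linear_rinner_right: "bounded_linear (rinner x)"
  by (rule bounded_linear_intro[where K = "norm x"])
    (simp_all add: rinner_add_right rinner_scaleR_right abs_rinner_le mult.commute[of _ "norm x"])

lemma eq_if_rinner_eq:
  assumes "\<And>z. rinner x z = rinner y z"
  shows "x = y"
proof -
  have "(norm (x - y))\<^sup>2 = 0"
    unfolding rinner_self[symmetric] by (simp add: rinner_diff_left assms)
  then show ?thesis
    by simp
qed

section \<open>Riesz representation and orthogonal vectors\<close>

text \<open>By the parallelogram law, every minimising sequence of \<open>\<parallel>x\<parallel>\<^sup>2 - 2 f x\<close> on \<open>M\<close> is Cauchy. The first
  variation at its limit vanishes, which is the asserted identity.\<close>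

lemma riesz_closed_subspace:
  fixes f :: "'a::right_quat_hilbert \<Rightarrow> real"
  assumes f: "bounded_linear f" and M: "subspace M" "closed M"
  obtains y where "y \<in> M" and "\<And>x. x \<in> M \<Longrightarrow> rinner y x = f x"
proof -
  interpret f: bounded_linear f by (rule f)
  obtain K where K: "\<And>x. norm (f x) \<le> norm x * K"
    using f.bounded by blast
  define F where "F x = (norm x)\<^sup>2 - 2 * f x" for x
  have F_ge: "- K\<^sup>2 \<le> F x" for x
  proof -
    have "0 \<le> (norm x - K)\<^sup>2" by simp
    then have "- K\<^sup>2 \<le> (norm x)\<^sup>2 - 2 * (norm x * K)"
      by (simp add: power2_diff)
    also have "\<dots> \<le> F x"
      using K[of x] by (simp add: F_def)
    finally show ?thesis .
  qed
  have bdd: "bdd_below (F ` M)"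
    by (rule bdd_belowI2[OF F_ge])
  define m where "m = Inf (F ` M)"
  have m_le: "m \<le> F x" if "x \<in> M" for x
    unfolding m_def using bdd that by (intro cInf_lower) auto
  have "F ` M \<noteq> {}"
    using subspace_0[OF M(1)] by blast
  then have "\<exists>x\<in>M. F x < m + 1 / real (Suc n)" for n
    using cInf_lessD[of "F ` M" "m + 1 / real (Suc n)"] by (auto simp: m_def)
  then obtain u where u: "\<And>n. u n \<in> M" and F_u: "\<And>n. F (u n) < m + 1 / real (Suc n)"
    by metis
  have dist_u: "(norm (u i - u j))\<^sup>2 \<le> 4 / real (Suc N)" if "i \<ge> N" "j \<ge> N" for i j N
  proof -
    have "(1/2) *\<^sub>R (u i + u j) \<in> M"
      by (intro subspace_scale subspace_add M(1) u)
    moreover have "(norm (u i - u j))\<^sup>2 = 2 * F (u i) + 2 * F (u j) - 4 * F ((1/2) *\<^sub>R (u i + u j))"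
      unfolding F_def f.add f.scaleR parallelogram_law norm_scaleR
      by (simp add: power_mult_distrib power_divide field_simps)
    ultimately have "(norm (u i - u j))\<^sup>2 \<le> 2 * F (u i) + 2 * F (u j) - 4 * m"
      using m_le[of "(1/2) *\<^sub>R (u i + u j)"] by linarith
    moreover have "1 / real (Suc i) \<le> 1 / real (Suc N)" "1 / real (Suc j) \<le> 1 / real (Suc N)"
      using that by (auto intro!: divide_left_mono)
    ultimately show ?thesis
      using F_u[of i] F_u[of j] by linarith
  qed
  have "Cauchy u"
  proof (rule metric_CauchyI)
    fix e :: real assume "e > 0"
    then obtain N where N: "4 / e\<^sup>2 < real N"
      using reals_Archimedean2 by blast
    then have "4 / real (Suc N) < e\<^sup>2"
      using \<open>e > 0\<close> by (simp add: field_simps) (smt (verit) zero_le_power2)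
    then have "norm (u i - u j) < e" if "i \<ge> N" "j \<ge> N" for i j
      using dist_u[OF that] \<open>e > 0\<close> by (intro power2_less_imp_less[of _ e]) auto
    then show "\<exists>N. \<forall>i\<ge>N. \<forall>j\<ge>N. dist (u i) (u j) < e"
      by (auto simp: dist_norm)
  qed
  then obtain y where y: "u \<longlonglongrightarrow> y"
    using Cauchy_convergent convergent_def by blast
  have "y \<in> M"
    using closed_sequentially[OF M(2)] u y by blast
  have "(\<lambda>n. F (u n)) \<longlonglongrightarrow> F y"
    unfolding F_def by (intro tendsto_intros f.tendsto y)
  moreover have "(\<lambda>n. m + 1 / real (Suc n)) \<longlonglongrightarrow> m + 0"
    by (intro tendsto_add tendsto_const lim_1_over_n[THEN LIMSEQ_Suc])
  ultimately have F_y: "F y \<le> m"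
    using F_u by (intro LIMSEQ_le[of "\<lambda>n. F (u n)"]) (auto intro: less_imp_le)
  have "rinner y x = f x" if "x \<in> M" for x
  proof -
    have "t\<^sup>2 * (norm x)\<^sup>2 + 2 * t * (rinner y x - f x) \<ge> 0" for t
    proof -
      have "F y \<le> F (y + t *\<^sub>R x)"
        using F_y m_le[of "y + t *\<^sub>R x"] M(1) \<open>y \<in> M\<close> that
        by (fastforce intro: subspace_add subspace_scale)
      then show ?thesis
        by (simp add: F_def norm_sq_add rinner_scaleR_right f.add f.scaleR power_mult_distrib
            algebra_simps)
    qed
    then show ?thesis
      using linear_coeff_eq_0_if_quadratic_nonneg[of "(norm x)\<^sup>2" "rinner y x - f x"] by simp
  qed
  then show thesis
    using that \<open>y \<in> M\<close> by blast
qed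

text \<open>The vector is \<open>v - y\<close>, where \<open>v\<close> lies outside \<open>M\<close> and \<open>y\<close> is its orthogonal projection to \<open>M\<close>, obtained as
  the Riesz vector of \<open>\<langle>v|\<cdot>\<rangle>\<close> on \<open>M\<close>.\<close>

lemma orthogonal_vector_exists:
  fixes M :: "'a::right_quat_hilbert set"
  assumes "subspace M" "closed M" "M \<noteq> UNIV"
  obtains w where "w \<noteq> 0" and "\<And>x. x \<in> M \<Longrightarrow> rinner w x = 0"
proof -
  obtain v where v: "v \<notin> M"
    using assms(3) by blast
  obtain y where y: "y \<in> M" "\<And>x. x \<in> M \<Longrightarrow> rinner y x = rinner v x"
    using riesz_closed_subspace[OF bounded_linear_rinner_right assms(1,2)] by metis
  show thesis
    using that[of "v - y"] v y by (auto simp: rinner_diff_left)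
qed

lemma subspace_closure:
  fixes M :: "'a::real_normed_vector set"
  assumes M: "subspace M"
  shows "subspace (closure M)"
proof (rule subspaceI)
  show "0 \<in> closure M"
    using subspace_0[OF M] closure_subset by blast
next
  fix x y assume "x \<in> closure M" "y \<in> closure M"
  then obtain u v where "\<And>n. u n \<in> M" "u \<longlonglongrightarrow> x" "\<And>n. v n \<in> M" "v \<longlonglongrightarrow> y"
    by (auto simp: closure_sequential)
  then show "x + y \<in> closure M"
    unfolding closure_sequential
    by (intro exI[of _ "\<lambda>n. u n + v n"] conjI allI subspace_add[OF M] tendsto_add)
next
  fix r x assume "x \<in> closure M"
  then obtain u where "\<And>n. u n \<in> M" "u \<longlonglongrightarrow> x"
    by (auto simp: closure_sequential)
  then show "r *\<^sub>R x \<in> closure M"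
    unfolding closure_sequential
    by (intro exI[of _ "\<lambda>n. r *\<^sub>R u n"] conjI allI subspace_scale[OF M] tendsto_scaleR tendsto_const)
qed

section \<open>The adjoint\<close>

lemma quat_eq_if_qRe_mult_eq:
  assumes "\<And>r. qRe (p * r) = qRe (p' * r)"
  shows "p = p'"
  using assms[of "Quat 1 0 0 0"] assms[of "Quat 0 1 0 0"] assms[of "Quat 0 0 1 0"]
    assms[of "Quat 0 0 0 1"]
  by (simp add: quat_eq_iff)

text \<open>The Riesz vectors of the real functionals \<open>\<phi> \<mapsto> Re \<langle>\<psi>|A \<phi>\<rangle>\<close> form a real adjoint. Right linearity of \<open>A\<close>
  makes it a quaternionic one, by testing with all \<open>\<phi> r\<close>.\<close>

lemma qinner_qadjoint:
  fixes A :: "'a::right_quat_hilbert \<Rightarrow> 'a"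
  assumes A: "A \<in> bounded_right_ops"
  shows "qinner \<psi> (A \<phi>) = qinner (qadjoint A \<psi>) \<phi>"
proof -
  have bl: "bounded_linear A" and right: "\<And>x r. A (x *\<^sub>H r) = A x *\<^sub>H r"
    using A by (auto simp: bounded_right_ops_def)
  have "\<exists>b. \<forall>\<phi>. rinner b \<phi> = rinner \<psi> (A \<phi>)" for \<psi>
    using riesz_closed_subspace[OF bounded_linear_compose[OF bounded_linear_rinner_right bl]
        subspace_UNIV closed_UNIV]
    by (metis UNIV_I)
  then obtain B where B: "\<And>\<psi> \<phi>. rinner (B \<psi>) \<phi> = rinner \<psi> (A \<phi>)"
    by metis
  have B_adj: "qinner \<psi> (A \<phi>) = qinner (B \<psi>) \<phi>" for \<psi> \<phi>
  proof (rule quat_eq_if_qRe_mult_eq)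
    fix r
    show "qRe (qinner \<psi> (A \<phi>) * r) = qRe (qinner (B \<psi>) \<phi> * r)"
      using B[of \<psi> "\<phi> *\<^sub>H r"] by (simp only: rinner_def right qinner_scaleH_right)
  qed
  have "qadjoint A = B"
    unfolding qadjoint_def
  proof (rule the_equality)
    fix B' assume B': "\<forall>\<phi> \<psi>. qinner \<psi> (A \<phi>) = qinner (B' \<psi>) \<phi>"
    show "B' = B"
    proof
      fix \<psi>
      show "B' \<psi> = B \<psi>"
        by (rule eq_if_rinner_eq) (metis B' B_adj rinner_def)
    qed
  qed (simp add: B_adj)
  then show ?thesis
    by (simp add: B_adj)
qed

lemma norm_qcnj: "norm (qcnj q) = norm q"
  by (simp add: norm_quat_def)

text \<open>The coefficients \<open>2 Re q\<close> and \<open>|q|\<^sup>2\<close> are real, so they move across the inner product unchanged, and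
  they are invariant under conjugation of \<open>q\<close>.\<close>

lemma rinner_R_op_qadjoint:
  assumes "A \<in> bounded_right_ops"
  shows "rinner \<psi> (R_op q A \<phi>) = rinner (R_op (qcnj q) (qadjoint A) \<psi>) \<phi>"
proof -
  have "rinner \<psi> (A \<phi>) = rinner (qadjoint A \<psi>) \<phi>" for \<psi> \<phi>
    by (simp add: rinner_def qinner_qadjoint[OF assms])
  then show ?thesis
    by (simp add: R_op_def norm_qcnj rinner_add_right rinner_diff_right rinner_scaleR_right
        rinner_add_left rinner_diff_left rinner_scaleR_left)
qed

section \<open>Compression spectrum and right spectrum\<close>

lemma R_op_bounded_right_ops:
  assumes "A \<in> bounded_right_ops"
  shows "R_op q A \<in> bounded_right_ops"
proof -
  have bl: "bounded_linear A" and right: "\<And>x r. A (x *\<^sub>H r) = A x *\<^sub>H r"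
    using assms by (auto simp: bounded_right_ops_def)
  have "bounded_linear (R_op q A)"
    unfolding R_op_def
    by (intro bounded_linear_add bounded_linear_sub bounded_linear_compose[OF bl bl]
        bounded_linear_const_scaleR bl bounded_linear_ident)
  moreover have "R_op q A (x *\<^sub>H r) = R_op q A x *\<^sub>H r" for x r
  proof -
    have diff: "(y - z) *\<^sub>H r = y *\<^sub>H r - z *\<^sub>H r" for y z :: 'a
      by (metis add_diff_cancel diff_add_cancel scaleH_add_left)
    have scaleR: "(c *\<^sub>R y) *\<^sub>H r = c *\<^sub>R (y *\<^sub>H r)" for c and y :: 'a
      by (simp add: scaleR_eq_scaleH scaleH_scaleH of_real_def)
    show ?thesis
      by (simp add: R_op_def right diff scaleR scaleH_add_left)
  qed
  ultimately show ?thesis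
    by (simp add: bounded_right_ops_def)
qed

text \<open>If the range is not dense, a nonzero vector orthogonal to its closure is annihilated by the
  adjoint; conversely, a vector in the kernel of the adjoint is orthogonal to the closure of the range,
  so it would be orthogonal to itself if the range were dense.\<close>

lemma compression_spectrum_iff_point_spectrum_qadjoint:
  assumes A: "A \<in> bounded_right_ops"
  shows "q \<in> spherical_compression_spectrum A \<longleftrightarrow>
    qcnj q \<in> spherical_point_spectrum (qadjoint A)"
proof
  let ?R = "R_op q A" and ?S = "R_op (qcnj q) (qadjoint A)"
  have bl: "bounded_linear ?R"
    using R_op_bounded_right_ops[OF A] by (simp add: bounded_right_ops_def)
  {
    assume "q \<in> spherical_compression_spectrum A"
    moreover have "subspace (closure (range ?R))"
      using bl
      by (intro subspace_closure linear_subspace_image subspace_UNIV bounded_linear.linear)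
    ultimately obtain w where "w \<noteq> 0" and w: "\<And>x. x \<in> closure (range ?R) \<Longrightarrow> rinner w x = 0"
      using orthogonal_vector_exists[of "closure (range ?R)"]
      by (auto simp: spherical_compression_spectrum_def)
    have "rinner w (?R (?S w)) = 0"
      using w closure_subset[of "range ?R"] by blast
    then have "?S w = 0"
      by (simp add: rinner_R_op_qadjoint[OF A] rinner_self)
    with \<open>w \<noteq> 0\<close> show "qcnj q \<in> spherical_point_spectrum (qadjoint A)"
      by (auto simp: spherical_point_spectrum_def)
  }
  {
    assume "qcnj q \<in> spherical_point_spectrum (qadjoint A)"
    moreover have "?S 0 = 0"
    proof (rule eq_if_rinner_eq)
      fix z :: 'a
      have "rinner 0 x = 0" for x :: 'a
        using rinner_scaleR_left[of 0 0 x] by simp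
      then show "rinner (?S 0) z = rinner 0 z"
        by (simp flip: rinner_R_op_qadjoint[OF A])
    qed
    ultimately obtain w where "w \<noteq> 0" and w: "?S w = 0"
      by (auto simp: spherical_point_spectrum_def)
    have "rinner w (?R x) = 0" for x
      using rinner_scaleR_left[of 0 0 x] by (simp add: rinner_R_op_qadjoint[OF A] w)
    then have "range ?R \<subseteq> {x. rinner w x = 0}"
      by blast
    moreover have "closed {x. rinner w x = 0}"
      by (intro closed_Collect_eq continuous_on_const linear_continuous_on
          bounded_linear_rinner_right)
    ultimately have "closure (range ?R) \<subseteq> {x. rinner w x = 0}"
      by (rule closure_minimal)
    moreover have "rinner w w \<noteq> 0"
      using \<open>w \<noteq> 0\<close> by (simp add: rinner_self)
    ultimately show "q \<in> spherical_compression_spectrum A"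
      by (auto simp: spherical_compression_spectrum_def)
  }
qed

lemma compression_spectrum_subset_right_S_spectrum:
  "spherical_compression_spectrum A \<subseteq> right_S_spectrum A"
proof
  fix q assume q: "q \<in> spherical_compression_spectrum A"
  have "range (R_op q A) = UNIV" if "R_op q A \<circ> B = id" for B
    using that by (metis comp_apply id_apply surj_def)
  with q show "q \<in> right_S_spectrum A"
    by (auto simp: spherical_compression_spectrum_def right_S_spectrum_def)
qed

section \<open>Decomposition of the spectrum\<close>

text \<open>If no lower bound \<open>1 / (n + 1)\<close> works, the normalised counterexamples are unit vectors
  whose images under \<open>R\<^sub>q(A)\<close> tend to zero.\<close>

lemma bounded_below_if_not_approx_S_point_spectrum:
  assumes A: "A \<in> bounded_right_ops" and q: "q \<notin> approx_S_point_spectrum A"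
  obtains c where "c > 0" and "\<And>x. c * norm x \<le> norm (R_op q A x)"
proof -
  interpret R: bounded_linear "R_op q A"
    using R_op_bounded_right_ops[OF A] by (simp add: bounded_right_ops_def)
  have "\<exists>c>0. \<forall>x. c * norm x \<le> norm (R_op q A x)"
  proof (rule ccontr)
    assume "\<not> ?thesis"
    then have "\<exists>x. norm (R_op q A x) < 1 / real (Suc n) * norm x" for n
      by (metis not_le of_nat_0_less_iff zero_less_Suc zero_less_divide_1_iff)
    then obtain x where x: "\<And>n. norm (R_op q A (x n)) < 1 / real (Suc n) * norm (x n)"
      by metis
    have x_nz: "x n \<noteq> 0" for n
      using x[of n] by auto
    define \<phi> where "\<phi> n = inverse (norm (x n)) *\<^sub>R x n" for n
    have "norm (R_op q A (\<phi> n)) \<le> 1 / real (Suc n)" for n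
      using x[of n] x_nz[of n] by (simp add: \<phi>_def R.scaleR field_simps)
    then have "(\<lambda>n. norm (R_op q A (\<phi> n))) \<longlonglongrightarrow> 0"
      by (intro tendsto_sandwich[OF _ _ tendsto_const lim_1_over_n[THEN LIMSEQ_Suc]]) auto
    moreover have "norm (\<phi> n) = 1" for n
      by (simp add: \<phi>_def x_nz)
    ultimately show False
      using q by (auto simp: approx_S_point_spectrum_def)
  qed
  then show thesis
    using that by blast
qed

text \<open>The lower bound makes the preimages of a convergent sequence in the range a Cauchy sequence.\<close>

lemma closed_range_if_bounded_below:
  fixes T :: "'a::{real_normed_vector, complete_space} \<Rightarrow> 'b::real_normed_vector"
  assumes T: "bounded_linear T" and "c > 0" and below: "\<And>x. c * norm x \<le> norm (T x)"
  shows "closed (range T)"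
  using complete_isometric_image[OF \<open>c > 0\<close> subspace_UNIV T] below complete_UNIV
  by (blast intro: complete_imp_closed)

lemma not_S_spectrum_if_bounded_below_and_dense:
  assumes A: "A \<in> bounded_right_ops" and "c > 0"
    and below: "\<And>x. c * norm x \<le> norm (R_op q A x)"
    and dense: "closure (range (R_op q A)) = UNIV"
  shows "q \<notin> S_spectrum A"
proof -
  let ?R = "R_op q A"
  have bl: "bounded_linear ?R" and right: "\<And>x r. ?R (x *\<^sub>H r) = ?R x *\<^sub>H r"
    using R_op_bounded_right_ops[OF A] by (auto simp: bounded_right_ops_def)
  interpret R: bounded_linear ?R by (rule bl)
  have "inj ?R"
  proof (rule injI)
    fix x y assume "?R x = ?R y"
    then have "c * norm (x - y) \<le> 0"
      using below[of "x - y"] by (simp add: R.diff)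
    then show "x = y"
      using \<open>c > 0\<close> by (simp add: mult_le_0_iff)
  qed
  moreover have "surj ?R"
    using closed_range_if_bounded_below[OF bl \<open>c > 0\<close> below] dense by simp
  ultimately have left_inv: "inv ?R (?R x) = x" and right_inv: "?R (inv ?R x) = x" for x
    by (auto simp: surj_f_inv_f)
  have inv_eqI: "inv ?R y = x" if "?R x = y" for x y
    using that left_inv by blast
  have "bounded_linear (inv ?R)"
  proof (rule bounded_linear_intro[where K = "1 / c"])
    show "inv ?R (x + y) = inv ?R x + inv ?R y" for x y
      by (rule inv_eqI) (simp add: R.add right_inv)
    show "inv ?R (r *\<^sub>R x) = r *\<^sub>R inv ?R x" for r x
      by (rule inv_eqI) (simp add: R.scaleR right_inv)
    show "norm (inv ?R x) \<le> norm x * (1 / c)" for x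
      using below[of "inv ?R x"] \<open>c > 0\<close> by (simp add: right_inv field_simps)
  qed
  moreover have "inv ?R (x *\<^sub>H r) = inv ?R x *\<^sub>H r" for x r
    by (rule inv_eqI) (simp add: right right_inv)
  ultimately have "inv ?R \<in> bounded_right_ops"
    by (simp add: bounded_right_ops_def)
  moreover have "?R \<circ> inv ?R = id" "inv ?R \<circ> ?R = id"
    by (auto simp: left_inv right_inv)
  ultimately show ?thesis
    by (auto simp: S_spectrum_def)
qed

text \<open>A bounded inverse would carry the null sequence \<open>R\<^sub>q(A) \<phi>\<^sub>n\<close> back to the unit vectors \<open>\<phi>\<^sub>n\<close>.\<close>

lemma approx_S_point_spectrum_subset_S_spectrum:
  "approx_S_point_spectrum A \<subseteq> S_spectrum A"
proof
  fix q assume "q \<in> approx_S_point_spectrum A"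
  then obtain \<phi> where unit: "\<And>n. norm (\<phi> n) = 1"
    and lim: "(\<lambda>n. norm (R_op q A (\<phi> n))) \<longlonglongrightarrow> 0"
    by (auto simp: approx_S_point_spectrum_def)
  have False if "B \<in> bounded_right_ops" and inv: "B \<circ> R_op q A = id" for B
  proof -
    interpret B: bounded_linear B
      using that by (simp add: bounded_right_ops_def)
    have "(\<lambda>n. norm (B (R_op q A (\<phi> n)))) \<longlonglongrightarrow> norm (B 0)"
      using lim by (intro tendsto_norm B.tendsto) (simp add: tendsto_norm_zero_iff)
    moreover have "B (R_op q A x) = x" for x
      using inv by (metis comp_apply id_apply)
    ultimately have "(\<lambda>n. 1) \<longlonglongrightarrow> (0::real)"
      by (simp add: unit B.zero)
    then show False
      by (simp add: LIMSEQ_const_iff)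
  qed
  then show "q \<in> S_spectrum A"
    by (auto simp: S_spectrum_def)
qed

lemma S_spectrum_eq_approx_Un_compression:
  assumes A: "A \<in> bounded_right_ops"
  shows "S_spectrum A = approx_S_point_spectrum A \<union> spherical_compression_spectrum A"
proof
  show "S_spectrum A \<subseteq> approx_S_point_spectrum A \<union> spherical_compression_spectrum A"
  proof (rule subsetI, rule ccontr)
    fix q assume S: "q \<in> S_spectrum A"
      and "q \<notin> approx_S_point_spectrum A \<union> spherical_compression_spectrum A"
    then have "q \<notin> approx_S_point_spectrum A" and dense: "closure (range (R_op q A)) = UNIV"
      by (auto simp: spherical_compression_spectrum_def)
    then obtain c where "c > 0" "\<And>x. c * norm x \<le> norm (R_op q A x)"
      using bounded_below_if_not_approx_S_point_spectrum[OF A] by metis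
    then show False
      using not_S_spectrum_if_bounded_below_and_dense[OF A] dense S by blast
  qed
  have "right_S_spectrum A \<subseteq> S_spectrum A"
    by (auto simp: right_S_spectrum_def S_spectrum_def)
  then show "approx_S_point_spectrum A \<union> spherical_compression_spectrum A \<subseteq> S_spectrum A"
    using approx_S_point_spectrum_subset_S_spectrum compression_spectrum_subset_right_S_spectrum
    by blast
qed

theorem proposition5p8:
  fixes A :: "'a::right_quat_hilbert \<Rightarrow> 'a" and q :: quat
  assumes separable: "separable_space (euclidean :: 'a topology)"
    and A: "A \<in> bounded_right_ops"
  shows "(q \<in> spherical_compression_spectrum A \<longleftrightarrow>
            qcnj q \<in> spherical_point_spectrum (qadjoint A)) \<and>
         spherical_compression_spectrum A \<subseteq> right_S_spectrum A \<and>
         S_spectrum A = approx_S_point_spectrum A \<union> spherical_compression_spectrum A"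
  using compression_spectrum_iff_point_spectrum_qadjoint[OF A]
    compression_spectrum_subset_right_S_spectrum S_spectrum_eq_approx_Un_compression[OF A]
  by blast

end
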